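(* For $n\ge1$, the normalized median Genocchi number $h_{n+1}$ satisfies $$h_{n+1}=\sum_{f_1,\dots,f_n\ge0}\ \prod_{k=1}^n\binom{1+f_{k-1}}{f_k}\prod_{k=1}^n\binom{1+f_{k+1}}{f_k},$$ with $f_0=f_{n+1}=0$.
   Context: The normalized median Genocchi number $h_m$ is the number of collections $(S_1,\dots,S_{m-1})$ of subsets $S_i\subset\{1,\dots,m\}$ with $\#S_i=i$ for $1\le i\le m-1$ and $S_i\subset S_{i+1}\cup\{i+1\}$ for $1\le i\le m-2$. For $m=1,2,3,4,5$ these numbers are $1,2,7,38,295$. (Equivalently, $h_{n+1}$ is the Euler characteristic of the complete degenerate flag variety $\mathcal{F}^a_{n+1}$, the variety of collections of subspaces $V_i\subset W=\mathbb{C}^{n+1}$, $\dim V_i=i$, $1\le i\le n$, with $pr_{i+1}V_i\subset V_{i+1}$ for $1\le i\le n-1$, where $pr_k$ is the projection of $W$ along the $k$-th basis vector onto the span of the remaining basis vectors.) Binomial coefficients $\binom{N}{M}$ are zero if $N<M$. *)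

theory Defs
  imports "HOL-Analysis.Analysis"
begin

text \<open>
  A collection (S_1, ..., S_{m-1}) is an extensional function on {1..<m}, so that distinct
  functions are distinct collections. For m = 1 there is exactly one (empty) collection.
\<close>
definition genocchi_collections :: "nat \<Rightarrow> (nat \<Rightarrow> nat set) set" where
  "genocchi_collections m =
     {S \<in> {1..<m} \<rightarrow>\<^sub>E Pow {1..m}.
        (\<forall>i\<in>{1..<m}. card (S i) = i) \<and>
        (\<forall>i\<in>{1..<m - 1}. S i \<subseteq> S (i + 1) \<union> {i + 1})}"

definition normalized_median_genocchi :: "nat \<Rightarrow> nat" where
  "normalized_median_genocchi m = card (genocchi_collections m)"

text \<open>
  A tuple (f_1, ..., f_n) of naturals is a sequence extended by zero outside {1..n}; this
  includes the boundary convention f_0 = f_{n+1} = 0.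
\<close>
definition zero_extended_tuples :: "nat \<Rightarrow> (nat \<Rightarrow> nat) set" where
  "zero_extended_tuples n = {f. \<forall>k. k \<notin> {1..n} \<longrightarrow> f k = 0}"

end

theory Submission
  imports Defs
begin

text \<open>
  Cut each set of a collection at its own index: with \<open>m = n + 1\<close>, split \<open>S\<^sub>k\<close> into
  \<open>S\<^sub>k \<inter> {1..k}\<close> and \<open>A\<^sub>k = S\<^sub>k \<inter> {k+1..n+1}\<close>, replace the first part by its complement
  \<open>C\<^sub>k = {1..k} - S\<^sub>k\<close>, and let \<open>f\<^sub>k = #A\<^sub>k\<close>. Then \<open>#S\<^sub>k = k\<close> says exactly that \<open>#C\<^sub>k = f\<^sub>k\<close> as well.
  The only element that may be lost in passing from \<open>S\<^sub>k\<close> to \<open>S\<^sub>k\<^sub>+\<^sub>1\<close> is \<open>k+1\<close>, which is also the only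
  one that moves from the upper to the lower range, so the inclusion
  \<open>S\<^sub>k \<subseteq> S\<^sub>k\<^sub>+\<^sub>1 \<union> {k+1}\<close> decouples into the two independent conditions
  \<open>C\<^sub>k\<^sub>+\<^sub>1 \<subseteq> C\<^sub>k \<union> {k+1}\<close> and \<open>A\<^sub>k \<subseteq> A\<^sub>k\<^sub>+\<^sub>1 \<union> {k+1}\<close>.

  Both are chains in which each set is a subset of the previous one enlarged by one new element:
  the \<open>C\<^sub>k\<close> for increasing \<open>k\<close>, starting from \<open>C\<^sub>0 = {}\<close>, and the \<open>A\<^sub>k\<close> for decreasing \<open>k\<close>, starting
  from \<open>A\<^sub>n\<^sub>+\<^sub>1 = {}\<close>. Choosing the sets one after another, there are \<open>(1 + f\<^sub>k\<^sub>-\<^sub>1) choose f\<^sub>k\<close> possibilities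
  for \<open>C\<^sub>k\<close> and \<open>(1 + f\<^sub>k\<^sub>+\<^sub>1) choose f\<^sub>k\<close> for \<open>A\<^sub>k\<close> (\<open>card_growth_chains\<close>). Hence the summand at \<open>f\<close>
  counts the collections with profile \<open>f\<close> (\<open>card_profile_fibre\<close>), and summing over all profiles
  counts all collections.
\<close>

section \<open>Chains that gain at most one new element per step\<close>

text \<open>
  Setting the sets outside \<open>{1..n}\<close> to \<open>{}\<close> makes these sequences extensional and at the same time
  supplies the initial set \<open>C 0 = {}\<close>.
\<close>
definition growth_chains :: "(nat \<Rightarrow> 'a) \<Rightarrow> nat \<Rightarrow> (nat \<Rightarrow> nat) \<Rightarrow> (nat \<Rightarrow> 'a set) set" where
  "growth_chains e n f =
     {C. (\<forall>k. k \<notin> {1..n} \<longrightarrow> C k = {}) \<and>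
         (\<forall>k\<in>{1..n}. C k \<subseteq> insert (e k) (C (k - 1)) \<and> card (C k) = f k)}"

lemma growth_chain_subset:
  assumes "C \<in> growth_chains e n f"
  shows "C k \<subseteq> e ` {1..k}"
proof (induction k)
  case 0
  then show ?case using assms by (simp add: growth_chains_def)
next
  case (Suc k)
  show ?case
  proof (cases "Suc k \<in> {1..n}")
    case True
    then have "C (Suc k) \<subseteq> insert (e (Suc k)) (C k)"
      using assms unfolding growth_chains_def by force
    with Suc.IH show ?thesis by (fastforce simp: image_iff)
  next
    case False
    then show ?thesis using assms by (simp add: growth_chains_def)
  qed
qed

lemma growth_chains_Suc:
  "bij_betw (\<lambda>(C, X). C(Suc n := X))
     (SIGMA C:growth_chains e n f. {X. X \<subseteq> insert (e (Suc n)) (C n) \<and> card X = f (Suc n)})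
     (growth_chains e (Suc n) f)"
proof (rule bij_betw_byWitness[where f' = "\<lambda>C. (C(Suc n := {}), C (Suc n))"], goal_cases)
  case 1
  then show ?case by (auto simp: growth_chains_def fun_eq_iff)
next
  case 2
  then show ?case by auto
next
  case 3
  show ?case
  proof (clarify)
    fix C X
    assume C: "C \<in> growth_chains e n f"
      and X: "X \<subseteq> insert (e (Suc n)) (C n)" "card X = f (Suc n)"
    have "(C(Suc n := X)) k \<subseteq> insert (e k) ((C(Suc n := X)) (k - 1)) \<and> card ((C(Suc n := X)) k) = f k"
      if "k \<in> {1..Suc n}" for k
      using that C X by (cases "k = Suc n") (auto simp: growth_chains_def)
    moreover have "(C(Suc n := X)) k = {}" if "k \<notin> {1..Suc n}" for k
      using that C by (auto simp: growth_chains_def)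
    ultimately show "C(Suc n := X) \<in> growth_chains e (Suc n) f"
      by (simp add: growth_chains_def)
  qed
next
  case 4
  show ?case
  proof (intro image_subsetI SigmaI)
    fix C
    assume C: "C \<in> growth_chains e (Suc n) f"
    have step: "C k \<subseteq> insert (e k) (C (k - 1)) \<and> card (C k) = f k" if "k \<in> {1..Suc n}" for k
      using C that by (simp add: growth_chains_def)
    have out: "C k = {}" if "k \<notin> {1..Suc n}" for k
      using C that by (simp add: growth_chains_def)
    have "(C(Suc n := {})) k \<subseteq> insert (e k) ((C(Suc n := {})) (k - 1)) \<and>
        card ((C(Suc n := {})) k) = f k"
      if "k \<in> {1..n}" for k
      using that step[of k] by auto
    moreover have "(C(Suc n := {})) k = {}" if "k \<notin> {1..n}" for k
      using that out[of k] by auto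
    ultimately show "C(Suc n := {}) \<in> growth_chains e n f"
      by (simp add: growth_chains_def)
    show "C (Suc n) \<in> {X. X \<subseteq> insert (e (Suc n)) ((C(Suc n := {})) n) \<and> card X = f (Suc n)}"
      using step[of "Suc n"] by simp
  qed
qed

text \<open>
  Injectivity of \<open>e\<close> makes the element offered at each step genuinely new, because all earlier sets
  consist of elements offered before; so the set to choose from has exactly \<open>1 + f (k - 1)\<close> elements.
\<close>
lemma card_growth_chains:
  assumes "inj_on e {1..n}" and "f 0 = 0"
  shows "finite (growth_chains e n f) \<and>
         card (growth_chains e n f) = (\<Prod>k=1..n. (1 + f (k - 1)) choose f k)"
  using assms(1)
proof (induction n)
  case 0
  have "growth_chains e 0 f = {\<lambda>_. {}}" by (auto simp: growth_chains_def)
  then show ?case by simp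
next
  case (Suc n)
  let ?next = "\<lambda>C. {X. X \<subseteq> insert (e (Suc n)) (C n) \<and> card X = f (Suc n)}"
  have "inj_on e {1..n}" using Suc.prems by (rule inj_on_subset) auto
  note IH = Suc.IH[OF this]
  have next_card: "finite (?next C) \<and> card (?next C) = (1 + f n) choose f (Suc n)"
    if C: "C \<in> growth_chains e n f" for C
  proof -
    have sub: "C n \<subseteq> e ` {1..n}" by (rule growth_chain_subset[OF C])
    then have fin: "finite (C n)" by (rule finite_subset) simp
    have "e (Suc n) \<notin> e ` {1..n}" using inj_onD[OF Suc.prems, of "Suc n"] by force
    with sub have "e (Suc n) \<notin> C n" by blast
    moreover have "card (C n) = f n"
      using C assms(2) by (cases "n = 0") (auto simp: growth_chains_def)
    ultimately have "card (insert (e (Suc n)) (C n)) = 1 + f n" using fin by simp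
    then show ?thesis using n_subsets[of "insert (e (Suc n)) (C n)"] fin by simp
  qed
  note bij = growth_chains_Suc[of n e f]
  have "finite (Sigma (growth_chains e n f) ?next)"
    using IH next_card by (intro finite_SigmaI) auto
  then have "finite (growth_chains e (Suc n) f)" using bij_betw_finite[OF bij] by blast
  moreover have "card (growth_chains e (Suc n) f) = card (Sigma (growth_chains e n f) ?next)"
    using bij_betw_same_card[OF bij] by simp
  moreover have "\<dots> = (\<Sum>C\<in>growth_chains e n f. card (?next C))"
    using IH next_card by (intro card_SigmaI) auto
  moreover have "\<dots> = card (growth_chains e n f) * ((1 + f n) choose f (Suc n))"
    using next_card by simp
  ultimately show ?case using IH by simp
qed

section \<open>Splitting a collection at the diagonal\<close>

definition profile :: "nat \<Rightarrow> (nat \<Rightarrow> nat set) \<Rightarrow> nat \<Rightarrow> nat" where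
  "profile n S k = (if k \<in> {1..n} then card (S k \<inter> {k<..}) else 0)"

definition lower_gaps :: "nat \<Rightarrow> (nat \<Rightarrow> nat set) \<Rightarrow> nat \<Rightarrow> nat set" where
  "lower_gaps n S k = (if k \<in> {1..n} then {1..k} - S k else {})"

text \<open>
  The upper parts grow as the index decreases, so they are listed backwards: position \<open>j\<close> holds the
  upper part of \<open>S (n + 1 - j)\<close>, whose potentially new element is \<open>n + 2 - j\<close>.
\<close>
definition upper_parts :: "nat \<Rightarrow> (nat \<Rightarrow> nat set) \<Rightarrow> nat \<Rightarrow> nat set" where
  "upper_parts n S j = (if j \<in> {1..n} then S (n + 1 - j) \<inter> {n + 1 - j<..} else {})"

definition glue :: "nat \<Rightarrow> (nat \<Rightarrow> nat set) \<Rightarrow> (nat \<Rightarrow> nat set) \<Rightarrow> nat \<Rightarrow> nat set" where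
  "glue n C D k = (if k \<in> {1..n} then ({1..k} - C k) \<union> D (n + 1 - k) else undefined)"

lemma genocchi_collections_iff:
  "S \<in> genocchi_collections (n + 1) \<longleftrightarrow>
     (\<forall>k. k \<notin> {1..n} \<longrightarrow> S k = undefined) \<and>
     (\<forall>k\<in>{1..n}. S k \<subseteq> {1..n + 1} \<and> card (S k) = k) \<and>
     (\<forall>k\<in>{1..<n}. S k \<subseteq> insert (k + 1) (S (k + 1)))"
proof -
  have "{1..<n + 1} = {1..n}" by auto
  then show ?thesis
    by (auto simp: genocchi_collections_def PiE_iff extensional_def)
qed

lemma finite_genocchi_collections: "finite (genocchi_collections m)"
  by (rule finite_subset[of _ "{1..<m} \<rightarrow>\<^sub>E Pow {1..m}"])
     (auto simp: genocchi_collections_def intro!: finite_PiE)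

text \<open>Since \<open>S k\<close> has \<open>k\<close> elements, it omits as many elements of \<open>{1..k}\<close> as it has beyond \<open>k\<close>.\<close>
lemma card_gaps_eq_card_excess:
  fixes A :: "nat set"
  assumes "finite A" and "card A = k" and "0 \<notin> A"
  shows "card ({1..k} - A) = card (A \<inter> {k<..})"
proof -
  have "A - {1..k} = A \<inter> {k<..}"
    using \<open>0 \<notin> A\<close> by (auto simp: not_le Suc_le_eq intro: gr0I)
  then show ?thesis
    using assms card_le_sym_Diff[of A "{1..k}"] card_le_sym_Diff[of "{1..k}" A] by simp
qed

lemma lower_gaps_in_growth_chains:
  assumes S: "S \<in> genocchi_collections (n + 1)"
  shows "lower_gaps n S \<in> growth_chains (\<lambda>k. k) n (profile n S)"
proof -
  note S = S[unfolded genocchi_collections_iff]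
  have "lower_gaps n S k \<subseteq> insert k (lower_gaps n S (k - 1)) \<and>
      card (lower_gaps n S k) = profile n S k" if k: "k \<in> {1..n}" for k
  proof
    have Sk: "S k \<subseteq> {1..n + 1}" "card (S k) = k" using S k by auto
    then have "finite (S k)" by (meson finite_atLeastAtMost finite_subset)
    moreover have "0 \<notin> S k" using Sk by auto
    ultimately show "card (lower_gaps n S k) = profile n S k"
      using card_gaps_eq_card_excess[of "S k" k] Sk k by (simp add: lower_gaps_def profile_def)
    show "lower_gaps n S k \<subseteq> insert k (lower_gaps n S (k - 1))"
    proof (cases "k = 1")
      case True
      then show ?thesis by (auto simp: lower_gaps_def)
    next
      case False
      then have "k - 1 \<in> {1..<n}" "k - 1 + 1 = k" using k by auto
      then have "S (k - 1) \<subseteq> insert k (S k)" using S by metis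
      then show ?thesis using k False by (auto simp: lower_gaps_def)
    qed
  qed
  then show ?thesis by (simp add: growth_chains_def lower_gaps_def)
qed

lemma upper_parts_in_growth_chains:
  assumes S: "S \<in> genocchi_collections (n + 1)"
  shows "upper_parts n S \<in> growth_chains (\<lambda>j. n + 2 - j) n (\<lambda>j. profile n S (n + 1 - j))"
proof -
  note S = S[unfolded genocchi_collections_iff]
  have "upper_parts n S j \<subseteq> insert (n + 2 - j) (upper_parts n S (j - 1)) \<and>
      card (upper_parts n S j) = profile n S (n + 1 - j)" if j: "j \<in> {1..n}" for j
  proof
    show "card (upper_parts n S j) = profile n S (n + 1 - j)"
      using j by (auto simp: upper_parts_def profile_def)
    show "upper_parts n S j \<subseteq> insert (n + 2 - j) (upper_parts n S (j - 1))"
    proof (cases "j = 1")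
      case True
      then have "S n \<subseteq> {1..n + 1}" using S j by auto
      then show ?thesis using True j by (auto simp: upper_parts_def)
    next
      case False
      define k where "k = n + 1 - j"
      have k: "k \<in> {1..<n}" "n + 2 - j = k + 1" "n + 1 - (j - 1) = k + 1" "j - 1 \<in> {1..n}"
        using j False by (auto simp: k_def)
      then have "S k \<subseteq> insert (k + 1) (S (k + 1))" using S by blast
      then have "S k \<inter> {k<..} \<subseteq> insert (k + 1) (S (k + 1) \<inter> {k + 1<..})" by auto
      moreover have "upper_parts n S j = S k \<inter> {k<..}"
        using j unfolding upper_parts_def k_def by (rule if_P)
      moreover have "upper_parts n S (j - 1) = S (k + 1) \<inter> {k + 1<..}"
        using k(4) unfolding upper_parts_def k(3) by (rule if_P)
      ultimately show ?thesis unfolding k(2) by simp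
    qed
  qed
  then show ?thesis by (simp add: growth_chains_def upper_parts_def)
qed

text \<open>
  A growth chain of lower gaps at \<open>k\<close> lies in \<open>{1..k}\<close>, and the reversed chain at the same index lies
  in \<open>{k+1..n+1}\<close>; gluing therefore loses no information.
\<close>
lemma glue_parts:
  assumes C: "C \<in> growth_chains (\<lambda>k. k) n f"
    and D: "D \<in> growth_chains (\<lambda>j. n + 2 - j) n (\<lambda>j. f (n + 1 - j))"
    and k: "k \<in> {1..n}"
  shows "C k \<subseteq> {1..k}" and "D (n + 1 - k) \<subseteq> {k<..n + 1}"
    and "card (C k) = f k" and "card (D (n + 1 - k)) = f k"
proof -
  show "C k \<subseteq> {1..k}" using growth_chain_subset[OF C, of k] by simp
  show "D (n + 1 - k) \<subseteq> {k<..n + 1}"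
    using growth_chain_subset[OF D, of "n + 1 - k"] k by fastforce
  show "card (C k) = f k" using C k by (simp add: growth_chains_def)
  have j: "n + 1 - k \<in> {1..n}" and kk: "n + 1 - (n + 1 - k) = k" using k by auto
  have "card (D (n + 1 - k)) = f (n + 1 - (n + 1 - k))"
    using D j unfolding growth_chains_def by blast
  then show "card (D (n + 1 - k)) = f k" unfolding kk .
qed

lemma glue_in_genocchi_collections:
  assumes C: "C \<in> growth_chains (\<lambda>k. k) n f"
    and D: "D \<in> growth_chains (\<lambda>j. n + 2 - j) n (\<lambda>j. f (n + 1 - j))"
  shows "glue n C D \<in> genocchi_collections (n + 1)"
proof -
  note parts = glue_parts[OF C D]
  have "glue n C D k \<subseteq> {1..n + 1} \<and> card (glue n C D k) = k" if k: "k \<in> {1..n}" for k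
  proof
    show "glue n C D k \<subseteq> {1..n + 1}"
      using parts(2)[OF k] k by (fastforce simp: glue_def)
    have fin: "finite (D (n + 1 - k))"
      using parts(2)[OF k] by (rule finite_subset) simp
    have "card (glue n C D k) = card ({1..k} - C k) + card (D (n + 1 - k))"
      using k parts(2)[OF k] fin by (auto simp: glue_def intro!: card_Un_disjoint)
    also have "card ({1..k} - C k) = k - f k"
      using parts(1,3)[OF k] by (simp add: card_Diff_subset finite_subset)
    also have "f k \<le> k"
      using card_mono[OF _ parts(1)[OF k]] parts(3)[OF k] by simp
    ultimately show "card (glue n C D k) = k" using parts(4)[OF k] by simp
  qed
  moreover have "glue n C D k \<subseteq> insert (k + 1) (glue n C D (k + 1))" if k: "k \<in> {1..<n}" for k
  proof -
    have "k + 1 \<in> {1..n}" using k by auto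
    then have "C (k + 1) \<subseteq> insert (k + 1) (C (k + 1 - 1))"
      using C unfolding growth_chains_def by blast
    moreover have "n + 1 - k \<in> {1..n}" using k by auto
    then have "D (n + 1 - k) \<subseteq> insert (n + 2 - (n + 1 - k)) (D (n + 1 - k - 1))"
      using D unfolding growth_chains_def by blast
    then have "D (n + 1 - k) \<subseteq> insert (k + 1) (D (n + 1 - (k + 1)))"
      using k by (simp add: Suc_diff_le)
    ultimately show ?thesis using k by (auto simp: glue_def)
  qed
  ultimately show ?thesis
    unfolding genocchi_collections_iff by (simp add: glue_def)
qed

lemma split_glue:
  assumes C: "C \<in> growth_chains (\<lambda>k. k) n f"
    and D: "D \<in> growth_chains (\<lambda>j. n + 2 - j) n (\<lambda>j. f (n + 1 - j))"
  shows "lower_gaps n (glue n C D) = C" and "upper_parts n (glue n C D) = D"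
    and "f \<in> zero_extended_tuples n \<Longrightarrow> profile n (glue n C D) = f"
proof -
  note parts = glue_parts[OF C D]
  have upper: "glue n C D k \<inter> {k<..} = D (n + 1 - k)" if k: "k \<in> {1..n}" for k
    using parts(2)[OF k] k by (auto simp: glue_def)
  show "lower_gaps n (glue n C D) = C"
  proof
    fix k
    show "lower_gaps n (glue n C D) k = C k"
    proof (cases "k \<in> {1..n}")
      case True
      then show ?thesis
        using parts(1,2)[OF True] by (fastforce simp: lower_gaps_def glue_def)
    next
      case False
      then show ?thesis using C by (auto simp: lower_gaps_def growth_chains_def)
    qed
  qed
  show "upper_parts n (glue n C D) = D"
  proof
    fix j
    show "upper_parts n (glue n C D) j = D j"
    proof (cases "j \<in> {1..n}")
      case True
      then have "n + 1 - j \<in> {1..n}" "n + 1 - (n + 1 - j) = j" by auto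
      with upper[of "n + 1 - j"] True show ?thesis unfolding upper_parts_def by simp
    next
      case False
      then show ?thesis using D by (auto simp: upper_parts_def growth_chains_def)
    qed
  qed
  show "profile n (glue n C D) = f" if "f \<in> zero_extended_tuples n"
    using that upper parts(4) by (auto simp: fun_eq_iff profile_def zero_extended_tuples_def)
qed

lemma glue_split:
  assumes S: "S \<in> genocchi_collections (n + 1)"
  shows "glue n (lower_gaps n S) (upper_parts n S) = S"
proof
  fix k
  note S = S[unfolded genocchi_collections_iff]
  show "glue n (lower_gaps n S) (upper_parts n S) k = S k"
  proof (cases "k \<in> {1..n}")
    case True
    then have "n + 1 - k \<in> {1..n}" "n + 1 - (n + 1 - k) = k" by auto
    then have "upper_parts n S (n + 1 - k) = S k \<inter> {k<..}"
      unfolding upper_parts_def by simp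
    moreover have "S k \<subseteq> {1..n + 1}" using S True by blast
    ultimately show ?thesis using True by (fastforce simp: glue_def lower_gaps_def)
  next
    case False
    then have "S k = undefined" using S by blast
    with False show ?thesis by (auto simp: glue_def)
  qed
qed

section \<open>Summing over profiles\<close>

lemma bij_betw_profile_fibre:
  assumes f: "f \<in> zero_extended_tuples n"
  shows "bij_betw (\<lambda>S. (lower_gaps n S, upper_parts n S))
           {S \<in> genocchi_collections (n + 1). profile n S = f}
           (growth_chains (\<lambda>k. k) n f \<times> growth_chains (\<lambda>j. n + 2 - j) n (\<lambda>j. f (n + 1 - j)))"
  by (rule bij_betw_byWitness[where f' = "\<lambda>(C, D). glue n C D"])
     (use f glue_split split_glue glue_in_genocchi_collections
        lower_gaps_in_growth_chains upper_parts_in_growth_chains in auto)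

lemma card_profile_fibre:
  assumes f: "f \<in> zero_extended_tuples n"
  shows "card {S \<in> genocchi_collections (n + 1). profile n S = f} =
         (\<Prod>k=1..n. (1 + f (k - 1)) choose f k) * (\<Prod>k=1..n. (1 + f (k + 1)) choose f k)"
proof -
  have f0: "f 0 = 0" "f (n + 1 - 0) = 0" using f by (auto simp: zero_extended_tuples_def)
  have "card (growth_chains (\<lambda>j. n + 2 - j) n (\<lambda>j. f (n + 1 - j))) =
      (\<Prod>j=1..n. (1 + f (n + 1 - (j - 1))) choose f (n + 1 - j))"
  proof -
    have "inj_on (\<lambda>j. n + 2 - j) {1..n}" by (auto simp: inj_on_def)
    from card_growth_chains[where f = "\<lambda>j. f (n + 1 - j)", OF this f0(2)] show ?thesis ..
  qed
  also have "\<dots> = (\<Prod>k=1..n. (1 + f (k + 1)) choose f k)"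
    by (rule prod.reindex_bij_witness[of _ "\<lambda>k. n + 1 - k" "\<lambda>j. n + 1 - j"])
       (auto simp: Suc_diff_le)
  finally show ?thesis
    using bij_betw_same_card[OF bij_betw_profile_fibre[OF f]]
      card_growth_chains[of "\<lambda>k. k" n f] f0
    by (simp add: card_cartesian_product)
qed

theorem corollary6p5:
  fixes n :: nat
  assumes "n \<ge> 1"
  shows "((\<lambda>f. (\<Prod>k=1..n. (1 + f (k - 1)) choose f k) * (\<Prod>k=1..n. (1 + f (k + 1)) choose f k))
           has_sum normalized_median_genocchi (n + 1)) (zero_extended_tuples n)"
proof -
  let ?G = "genocchi_collections (n + 1)"
  let ?fibre = "\<lambda>f. {S \<in> ?G. profile n S = f}"
  have sub: "profile n ` ?G \<subseteq> zero_extended_tuples n"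
    by (auto simp: profile_def zero_extended_tuples_def)
  have "card ?G = (\<Sum>f\<in>profile n ` ?G. card (?fibre f))"
    using sum.image_gen[OF finite_genocchi_collections, of "\<lambda>_. 1::nat" "n + 1" "profile n"] by simp
  then have fin: "((\<lambda>f. card (?fibre f)) has_sum card ?G) (profile n ` ?G)"
    by (intro has_sum_finiteI) (simp_all add: finite_genocchi_collections)
  \<comment> \<open>A tuple that is not a profile has an empty fibre, so its summand vanishes and only
      finitely many terms of the sum remain.\<close>
  have "card (?fibre f) = 0" if "f \<notin> profile n ` ?G" for f
  proof -
    have "?fibre f = {}" using that by auto
    then show ?thesis by (simp only: card.empty)
  qed
  then have "((\<lambda>f. card (?fibre f)) has_sum card ?G) (zero_extended_tuples n)"
    by (intro has_sum_cong_neutral[THEN iffD1, OF _ _ _ fin]) (use sub in auto)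
  then show ?thesis
    unfolding normalized_median_genocchi_def
    by (subst has_sum_cong[OF card_profile_fibre[symmetric]])
qed

end
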